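(* Let $F$ be a totally real cubic number field. A basis $(r_1,r_2,r_3)$ of $F$ over $\mathbb{Q}$ is admissible if and only if it is both rational and positive.
   Context: Let $Q\colon F\to F$ be $Q(x)=N^F_{\mathbb Q}(x)/x$. The basis $(r_1,r_2,r_3)$ is admissible if it satisfies the no-half-space condition: $0$ lies in the interior of the convex hull of $\{Q(r_1),Q(r_2),Q(r_3)\}$, the interior being taken in the $\mathbb{R}$-span of $Q(r_1),Q(r_2),Q(r_3)$ in $F\otimes_{\mathbb Q}\mathbb{R}$. Let $(s_1,s_2,s_3)$ be the dual basis for the trace pairing, $\operatorname{Tr}^F_{\mathbb Q}(r_is_j)=\delta_{ij}$. The basis is rational if $\frac{r_i}{s_i}\big/\frac{r_j}{s_j}\in\mathbb{Q}$ for all $i\neq j$, and positive if each $r_i/s_i$ is totally positive, i.e. positive under every embedding $F\to\mathbb{R}$. *)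

theory Defs
  imports "HOL-Analysis.Analysis"
begin

global_interpretation Q_vs: vector_space "\<lambda>(q::rat) (x::'a::field_char_0). of_rat q * x"
  by unfold_locales (auto simp: algebra_simps of_rat_add of_rat_mult)

definition Q_basis :: "('n::finite \<Rightarrow> 'a::field_char_0) \<Rightarrow> bool" where
  "Q_basis b \<longleftrightarrow> inj b \<and> Q_vs.independent (range b) \<and> Q_vs.span (range b) = UNIV"

definition Q_coord :: "('n::finite \<Rightarrow> 'a::field_char_0) \<Rightarrow> 'a \<Rightarrow> rat ^ 'n" where
  "Q_coord b x = (\<chi> i. Q_vs.representation (range b) x (b i))"

definition mult_matrix :: "('n::finite \<Rightarrow> 'a::field_char_0) \<Rightarrow> 'a \<Rightarrow> rat ^ 'n ^ 'n" where
  "mult_matrix b x = (\<chi> i j. Q_coord b (x * b j) $ i)"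

definition field_embedding :: "('a::field \<Rightarrow> 'b::field) \<Rightarrow> bool" where
  "field_embedding \<sigma> \<longleftrightarrow> \<sigma> 1 = 1 \<and> (\<forall>x y. \<sigma> (x + y) = \<sigma> x + \<sigma> y) \<and> (\<forall>x y. \<sigma> (x * y) = \<sigma> x * \<sigma> y)"

text \<open>
  The field is the whole type \<open>'a\<close>; its dimension over the rationals is the degree. (An infinite
  dimension is represented by 0 in \<^const>\<open>Q_vs.dim\<close>, so this condition includes finiteness.)
\<close>

definition totally_real_cubic_field :: "'a::field_char_0 itself \<Rightarrow> bool" where
  "totally_real_cubic_field _ \<longleftrightarrow>
     Q_vs.dim (UNIV :: 'a set) = 3 \<and>
     (\<forall>\<sigma> :: 'a \<Rightarrow> complex. field_embedding \<sigma> \<longrightarrow> range \<sigma> \<subseteq> \<real>)"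

definition totally_positive :: "'a::field \<Rightarrow> bool" where
  "totally_positive x \<longleftrightarrow> (\<forall>\<sigma> :: 'a \<Rightarrow> real. field_embedding \<sigma> \<longrightarrow> \<sigma> x > 0)"

text \<open>
  The notions below are meant for fields of degree 3 over the rationals; outside this case the
  reference basis is a junk value. Norm and trace do not depend on its choice, see
  \<open>cubic_norm_eq\<close> and \<open>cubic_trace_eq\<close>.
\<close>

definition ref_basis :: "3 \<Rightarrow> 'a::field_char_0" where
  "ref_basis = (SOME b. Q_basis b)"

definition cubic_norm :: "'a::field_char_0 \<Rightarrow> rat" where
  "cubic_norm x = det (mult_matrix ref_basis x)"

definition cubic_trace :: "'a::field_char_0 \<Rightarrow> rat" where
  "cubic_trace x = trace (mult_matrix ref_basis x)"

text \<open>
  The real vector space obtained from the field by tensoring with the reals is modelled as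
  \<^typ>\<open>real ^ 3\<close>, with \<open>real_tensor x\<close> for the image of \<open>x\<close>, i.e. of the tensor of \<open>x\<close> and 1.
  Lemma \<open>real_tensor_universal\<close> is the universal property of this extension of scalars.
\<close>

definition real_tensor :: "'a::field_char_0 \<Rightarrow> real ^ 3" where
  "real_tensor x = (\<chi> i. of_rat (Q_coord ref_basis x $ i))"

definition Qmap :: "'a::field_char_0 \<Rightarrow> 'a" where
  "Qmap x = of_rat (cubic_norm x) / x"

definition admissible :: "(3 \<Rightarrow> 'a::field_char_0) \<Rightarrow> bool" where
  "admissible r \<longleftrightarrow>
     (let P = range (\<lambda>i. real_tensor (Qmap (r i)))
      in 0 \<in> top_of_set (span P) interior_of (convex hull P))"

definition dual_basis :: "(3 \<Rightarrow> 'a::field_char_0) \<Rightarrow> 3 \<Rightarrow> 'a" where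
  "dual_basis r = (THE s. \<forall>i j. cubic_trace (r i * s j) = (if i = j then 1 else 0))"

definition rational_basis :: "(3 \<Rightarrow> 'a::field_char_0) \<Rightarrow> bool" where
  "rational_basis r \<longleftrightarrow>
     (\<forall>i j. i \<noteq> j \<longrightarrow> (r i / dual_basis r i) / (r j / dual_basis r j) \<in> \<rat>)"

definition positive_basis :: "(3 \<Rightarrow> 'a::field_char_0) \<Rightarrow> bool" where
  "positive_basis r \<longleftrightarrow> (\<forall>i. totally_positive (r i / dual_basis r i))"

lemma Q_basis_expand:
  assumes "Q_basis (b :: 'n::finite \<Rightarrow> 'a::field_char_0)"
  shows "(\<Sum>i\<in>UNIV. of_rat (Q_coord b x $ i) * b i) = x"
proof -
  have "(\<Sum>v\<in>range b. of_rat (Q_vs.representation (range b) x v) * v) = x"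
    using assms by (intro Q_vs.sum_representation_eq) (auto simp: Q_basis_def)
  thus ?thesis
    using assms by (subst (asm) sum.reindex) (auto simp: Q_basis_def Q_coord_def)
qed

lemma Q_coord_add:
  assumes "Q_basis b"
  shows "Q_coord b (x + y) = Q_coord b x + Q_coord b y"
  using assms by (simp add: Q_basis_def Q_coord_def vec_eq_iff Q_vs.representation_add)

lemma Q_coord_scale:
  assumes "Q_basis b"
  shows "Q_coord b (of_rat q * x) $ i = q * Q_coord b x $ i"
  using assms by (simp add: Q_basis_def Q_coord_def Q_vs.representation_scale)

lemma Q_coord_sum:
  assumes "Q_basis b"
  shows "Q_coord b (\<Sum>k\<in>A. f k) = (\<Sum>k\<in>A. Q_coord b (f k))"
proof -
  have 0: "Q_coord b 0 = 0"
    by (simp add: Q_coord_def vec_eq_iff Q_vs.representation_zero)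
  show ?thesis
    by (induction A rule: infinite_finite_induct) (simp_all add: 0 Q_coord_add[OF assms])
qed

lemma Q_coord_basis:
  assumes "Q_basis b"
  shows "Q_coord b (b j) $ i = (if i = j then 1 else 0)"
  using assms unfolding Q_basis_def Q_coord_def
  by (auto simp: Q_vs.representation_basis inj_eq)

lemma Q_coord_change:
  assumes b: "Q_basis b" and c: "Q_basis (c :: 'n::finite \<Rightarrow> 'a::field_char_0)"
  shows "(\<Sum>k\<in>UNIV. Q_coord b (x * c k) $ i * Q_coord c y $ k) = Q_coord b (x * y) $ i"
proof -
  have "x * y = x * (\<Sum>k\<in>UNIV. of_rat (Q_coord c y $ k) * c k)"
    by (simp add: Q_basis_expand[OF c])
  also have "\<dots> = (\<Sum>k\<in>UNIV. of_rat (Q_coord c y $ k) * (x * c k))"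
    by (simp add: sum_distrib_left algebra_simps)
  finally have "Q_coord b (x * y) $ i =
      (\<Sum>k\<in>UNIV. Q_coord b (of_rat (Q_coord c y $ k) * (x * c k))) $ i"
    by (simp only: Q_coord_sum[OF b])
  thus ?thesis
    unfolding sum_component Q_coord_scale[OF b] by (simp only: mult.commute)
qed

lemma mult_matrix_similar:
  assumes b: "Q_basis b" and c: "Q_basis (c :: 'n::finite \<Rightarrow> 'a::field_char_0)"
  obtains P Q where "P ** Q = mat 1" "Q ** P = mat 1"
    "mult_matrix b x = P ** (mult_matrix c x ** Q)"
proof
  define P where "P = (\<chi> i j. Q_coord b (c j) $ i)"
  define Q where "Q = (\<chi> i j. Q_coord c (b j) $ i)"
  note bc = Q_coord_change[OF b c, of 1, unfolded mult_1_left]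
  note cb = Q_coord_change[OF c b, of 1, unfolded mult_1_left]
  show "P ** Q = mat 1"
    by (simp add: P_def Q_def matrix_matrix_mult_def mat_def vec_eq_iff bc Q_coord_basis[OF b])
  show "Q ** P = mat 1"
    by (simp add: P_def Q_def matrix_matrix_mult_def mat_def vec_eq_iff cb Q_coord_basis[OF c])
  have 1: "mult_matrix c x ** Q = (\<chi> i j. Q_coord c (x * b j) $ i)"
    by (simp add: Q_def mult_matrix_def matrix_matrix_mult_def vec_eq_iff Q_coord_change[OF c c])
  show "mult_matrix b x = P ** (mult_matrix c x ** Q)"
    unfolding 1 by (simp add: P_def mult_matrix_def matrix_matrix_mult_def vec_eq_iff bc)
qed

lemma Q_basis_ref_basis:
  assumes "Q_vs.dim (UNIV :: 'a::field_char_0 set) = 3"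
  shows "Q_basis (ref_basis :: 3 \<Rightarrow> 'a)"
proof -
  obtain B :: "'a set" where B: "Q_vs.independent B" "UNIV \<subseteq> Q_vs.span B" "card B = Q_vs.dim (UNIV :: 'a set)"
    by (rule Q_vs.basis_exists[of UNIV])
  hence "card B = 3" using assms by simp
  hence "finite B" by (simp add: card_ge_0_finite)
  then obtain b :: "3 \<Rightarrow> 'a" where "bij_betw b UNIV B"
    using \<open>card B = 3\<close> finite_same_card_bij[of "UNIV :: 3 set" B] by auto
  hence "inj b" "range b = B"
    by (simp_all add: bij_betw_def)
  hence "Q_basis b"
    unfolding Q_basis_def using B(1) top.extremum_uniqueI[OF B(2)] by simp
  thus ?thesis unfolding ref_basis_def by (rule someI[of Q_basis])
qed

lemma cubic_norm_eq:
  fixes b :: "3 \<Rightarrow> 'a::field_char_0"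
  assumes "Q_vs.dim (UNIV :: 'a set) = 3" and "Q_basis b"
  shows "cubic_norm x = det (mult_matrix b x)"
proof -
  obtain P Q where PQ: "P ** Q = mat 1" "Q ** P = mat 1"
    "mult_matrix b x = P ** (mult_matrix ref_basis x ** Q)"
    using mult_matrix_similar[OF assms(2) Q_basis_ref_basis[OF assms(1)]] .
  have "det P * det Q = 1" using PQ(1) det_mul[of P Q] by simp
  thus ?thesis unfolding cubic_norm_def PQ(3) det_mul by (simp add: algebra_simps)
qed

lemma cubic_trace_eq:
  fixes b :: "3 \<Rightarrow> 'a::field_char_0"
  assumes "Q_vs.dim (UNIV :: 'a set) = 3" and "Q_basis b"
  shows "cubic_trace x = trace (mult_matrix b x)"
proof -
  obtain P Q where PQ: "P ** Q = mat 1" "Q ** P = mat 1"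
    "mult_matrix b x = P ** (mult_matrix ref_basis x ** Q)"
    using mult_matrix_similar[OF assms(2) Q_basis_ref_basis[OF assms(1)]] .
  have "trace (mult_matrix b x) = trace ((mult_matrix ref_basis x ** Q) ** P)"
    unfolding PQ(3) by (rule trace_mul_sym)
  thus ?thesis by (simp add: cubic_trace_def PQ(2) flip: matrix_mul_assoc)
qed

lemma real_tensor_add:
  assumes "Q_vs.dim (UNIV :: 'a::field_char_0 set) = 3"
  shows "real_tensor (x + y :: 'a) = real_tensor x + real_tensor y"
  by (simp add: real_tensor_def vec_eq_iff Q_coord_add[OF Q_basis_ref_basis[OF assms]] of_rat_add)

lemma real_tensor_scale:
  assumes "Q_vs.dim (UNIV :: 'a::field_char_0 set) = 3"
  shows "real_tensor (of_rat q * x :: 'a) = of_rat q *\<^sub>R real_tensor x"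
  by (simp add: real_tensor_def vec_eq_iff Q_coord_scale[OF Q_basis_ref_basis[OF assms]] of_rat_mult)

lemma real_tensor_universal:
  fixes f :: "'a::field_char_0 \<Rightarrow> 'v::real_vector"
  assumes dim: "Q_vs.dim (UNIV :: 'a set) = 3"
    and add: "\<And>x y. f (x + y) = f x + f y"
    and scale: "\<And>q x. f (of_rat q * x) = of_rat q *\<^sub>R f x"
  shows "\<exists>!g. linear g \<and> (\<forall>x. g (real_tensor x) = f x)"
proof
  let ?b = "ref_basis :: 3 \<Rightarrow> 'a"
  note b = Q_basis_ref_basis[OF dim]
  define g where "g v = (\<Sum>i\<in>UNIV. v $ i *\<^sub>R f (?b i))" for v :: "real ^ 3"
  have "f 0 = 0" using add[of 0 0] by simp
  hence f_sum: "f (sum h A) = (\<Sum>i\<in>A. f (h i))" for h and A :: "3 set"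
    by (induction A rule: infinite_finite_induct) (simp_all add: add)
  have "linear g"
    by (rule linearI) (simp_all add: g_def scaleR_add_left sum.distrib scaleR_sum_right)
  moreover have "g (real_tensor x) = f x" for x
  proof -
    have "f x = f (\<Sum>i\<in>UNIV. of_rat (Q_coord ?b x $ i) * ?b i)"
      by (simp only: Q_basis_expand[OF b])
    thus ?thesis by (simp add: f_sum scale g_def real_tensor_def)
  qed
  ultimately show "linear g \<and> (\<forall>x. g (real_tensor x) = f x)" by blast
  fix h assume h: "linear h \<and> (\<forall>x. h (real_tensor x) = f x)"
  have ax: "real_tensor (?b i) = axis i 1" for i
    by (simp add: real_tensor_def vec_eq_iff axis_def Q_coord_basis[OF b])
  show "h = g"
  proof
    fix v :: "real ^ 3"
    have "v = (\<Sum>i\<in>UNIV. v $ i *\<^sub>R real_tensor (?b i))"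
      unfolding ax using basis_expansion[of v] by (simp add: scalar_mult_eq_scaleR)
    hence "h v = h (\<Sum>i\<in>UNIV. v $ i *\<^sub>R real_tensor (?b i))" by simp
    also have "\<dots> = g v"
      using h by (simp add: linear_sum linear_cmul g_def)
    finally show "h v = g v" .
  qed
qed

end

theory Submission
  imports Defs
begin

text \<open>
  Since the \<open>Q(r\<^sub>i)\<close> are pairwise independent, admissibility means that \<open>\<Sum> a\<^sub>i Q(r\<^sub>i) = 0\<close> for some
  positive rationals \<open>a\<^sub>i\<close>. By Cayley--Hamilton, \<open>Q(x) = x\<^sup>2 - Tr(x) x + (Tr(x)\<^sup>2 - Tr(x\<^sup>2)) / 2\<close>, and \<open>Q\<close>
  is multiplicative, so the relation persists for the \<open>r\<^sub>i x\<close>; taking traces, it says that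
  \<open>\<Sum> a\<^sub>i Tr(r\<^sub>i x) r\<^sub>i = t x\<close> for all \<open>x\<close>, where \<open>t = \<Sum> a\<^sub>i r\<^sub>i\<^sup>2\<close>. This is the statement that the dual
  basis is \<open>s\<^sub>i = a\<^sub>i r\<^sub>i / t\<close>, which makes \<open>r\<^sub>i / s\<^sub>i = t / a\<^sub>i\<close> rational up to the common factor \<open>t\<close>, a
  totally positive element. Conversely \<open>\<Sum> r\<^sub>i s\<^sub>i = 1\<close> recovers the relation from \<open>s\<^sub>i = a\<^sub>i r\<^sub>i / t\<close>, and a real
  embedding (every cubic field has one) shows that the \<open>a\<^sub>i\<close> are positive.
\<close>

section \<open>The regular representation and coordinates in a rational basis\<close>

lemma mult_matrix_mult:
  assumes "Q_basis (b :: 'n::finite \<Rightarrow> 'a::field_char_0)"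
  shows "mult_matrix b (x * y) = mult_matrix b x ** mult_matrix b y"
  by (simp add: mult_matrix_def matrix_matrix_mult_def vec_eq_iff mult.assoc
      Q_coord_change[OF assms assms])

lemma mult_matrix_add:
  assumes "Q_basis b"
  shows "mult_matrix b (x + y) = mult_matrix b x + mult_matrix b y"
  by (simp add: mult_matrix_def vec_eq_iff distrib_right Q_coord_add[OF assms])

lemma mult_matrix_scale:
  assumes "Q_basis b"
  shows "mult_matrix b (of_rat q * x) $ i $ j = q * mult_matrix b x $ i $ j"
  by (simp add: mult_matrix_def mult.assoc Q_coord_scale[OF assms])

lemma mult_matrix_1:
  assumes "Q_basis b"
  shows "mult_matrix b 1 = mat 1"
  by (simp add: mult_matrix_def mat_def vec_eq_iff Q_coord_basis[OF assms])

lemma Q_coord_inject: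
  assumes "Q_basis b" "Q_coord b x = Q_coord b y"
  shows "x = y"
  by (metis Q_basis_expand assms)

text \<open>The regular representation is faithful, since some \<open>b i\<close> is nonzero and can
  be cancelled. Matrix identities such as Cayley-Hamilton thereby descend to the field.\<close>

lemma mult_matrix_inject:
  fixes b :: "'n::finite \<Rightarrow> 'a::field_char_0"
  assumes b: "Q_basis b" and eq: "mult_matrix b x = mult_matrix b y"
  shows "x = y"
proof -
  have "x * b i = y * b i" for i
    using eq by (intro Q_coord_inject[OF b]) (simp add: mult_matrix_def vec_eq_iff)
  moreover obtain i where "b i \<noteq> 0"
  proof (rule ccontr)
    assume "\<not> thesis"
    hence "b i = 0" for i using that by blast
    with Q_basis_expand[OF b, of 1] show False by simp
  qed
  ultimately show ?thesis by (metis mult_cancel_right)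
qed

lemma third_index:
  fixes i k :: 3
  assumes "i \<noteq> k"
  obtains j where "j \<noteq> i" "j \<noteq> k" "UNIV = {i, j, k}"
proof -
  have "card (UNIV - {i, k}) = 1"
    using assms by (simp add: card_Diff_subset)
  then obtain j where "UNIV - {i, k} = {j}" by (rule card_1_singletonE)
  thus thesis using that[of j] by blast
qed

lemma Q_basis_independent:
  assumes b: "Q_basis b" and "(\<Sum>i\<in>UNIV. of_rat (c i) * b i) = 0"
  shows "c i = 0"
proof -
  have "(\<Sum>k\<in>UNIV. c k * Q_coord b (b k) $ i) = Q_coord b 0 $ i"
    by (simp only: Q_coord_sum[OF b] sum_component Q_coord_scale[OF b] flip: assms(2))
  moreover have "Q_coord b 0 $ i = 0"
    using Q_coord_scale[OF b, of 0 0 i] by simp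
  ultimately show ?thesis by (simp add: Q_coord_basis[OF b] if_distrib cong: if_cong)
qed

lemma Q_basis_nonzero: "Q_basis b \<Longrightarrow> b i \<noteq> 0"
  using Q_vs.dependent_zero by (metis Q_basis_def rangeI)

text \<open>The coordinates of the \<open>b j\<close> form a square matrix with trivial kernel,
  hence one with a two-sided inverse, which yields the unique solution.\<close>

lemma independent_imp_coords:
  fixes b c :: "'n::finite \<Rightarrow> 'a::field_char_0"
  assumes c: "Q_basis c"
    and indep: "\<And>e :: rat ^ 'n. (\<Sum>i\<in>UNIV. of_rat (e $ i) * b i) = 0 \<Longrightarrow> e = 0"
  shows "\<exists>!e :: rat ^ 'n. (\<Sum>i\<in>UNIV. of_rat (e $ i) * b i) = y"
proof -
  define A :: "rat ^ 'n ^ 'n" where "A = (\<chi> i j. Q_coord c (b j) $ i)"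
  have A: "Q_coord c (\<Sum>i\<in>UNIV. of_rat (e $ i) * b i) = A *v e" for e :: "rat ^ 'n"
    by (simp add: Q_coord_sum[OF c] vec_eq_iff Q_coord_scale[OF c] A_def matrix_vector_mult_def
        mult.commute[of "Q_coord c _ $ _"])
  have Q_coord_0: "Q_coord c 0 = 0"
    using Q_coord_scale[OF c, of 0 0] by (simp add: vec_eq_iff)
  have "\<forall>e. A *v e = 0 \<longrightarrow> e = 0"
    by (intro allI impI, rule indep, rule Q_coord_inject[OF c]) (simp add: A Q_coord_0)
  then obtain B where B: "B ** A = mat 1"
    unfolding matrix_left_invertible_ker[symmetric] ..
  hence AB: "A ** B = mat 1" by (simp only: matrix_left_right_inverse)
  have "Q_coord c (\<Sum>i\<in>UNIV. of_rat (e $ i) * b i) = Q_coord c y \<longleftrightarrow> e = B *v Q_coord c y" for e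
  proof
    assume "Q_coord c (\<Sum>i\<in>UNIV. of_rat (e $ i) * b i) = Q_coord c y"
    hence "B *v (A *v e) = B *v Q_coord c y" by (simp only: A)
    thus "e = B *v Q_coord c y" by (simp only: matrix_vector_mul_assoc B matrix_vector_mul_lid)
  qed (simp only: A matrix_vector_mul_assoc AB matrix_vector_mul_lid)
  hence "(\<Sum>i\<in>UNIV. of_rat (e $ i) * b i) = y \<longleftrightarrow> e = B *v Q_coord c y" for e
    using Q_coord_inject[OF c] by metis
  thus ?thesis by simp
qed

text \<open>Extend \<open>{x}\<close> to a basis over the rationals and take the coordinate at
  \<open>x\<close>. No finiteness is assumed, so this covers the reals.\<close>

lemma exists_Q_functional:
  fixes x :: "'a::field_char_0"
  assumes "x \<noteq> 0"
  shows "\<exists>f :: 'a \<Rightarrow> rat. (\<forall>x y. f (x + y) = f x + f y) \<and> (\<forall>q x. f (of_rat q * x) = q * f x) \<and> f x = 1"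
proof (intro exI conjI allI)
  have "Q_vs.independent {x}" using assms Q_vs.dependent_single by blast
  note B = Q_vs.independent_extend_basis[OF this] Q_vs.span_extend_basis[OF this]
    Q_vs.extend_basis_superset[OF this]
  let ?f = "\<lambda>y. Q_vs.representation (Q_vs.extend_basis {x}) y x"
  show "?f (y + z) = ?f y + ?f z" for y z using B by (simp add: Q_vs.representation_add)
  show "?f (of_rat q * y) = q * ?f y" for q y using B by (simp add: Q_vs.representation_scale)
  show "?f x = 1" using B by (simp add: Q_vs.representation_basis)
qed

section \<open>Cubic polynomials and the Cayley-Hamilton identity\<close>

text \<open>Intermediate value theorem on \<open>{- M..M}\<close>, where \<open>M\<close> is so
  large that the cubic term decides the sign at both ends.\<close>

lemma real_cubic_root: "\<exists>\<alpha>::real. \<alpha> ^ 3 = u + v * \<alpha> + w * \<alpha> ^ 2"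
proof -
  define M where "M = 1 + \<bar>u\<bar> + \<bar>v\<bar> + \<bar>w\<bar>"
  define f where "f t = t ^ 3 - (u + v * t + w * t ^ 2)" for t
  have M: "M \<ge> 1" by (simp add: M_def)
  have bound: "\<bar>u + v * t + w * t ^ 2\<bar> \<le> M ^ 3" if "\<bar>t\<bar> = M" for t
  proof -
    have t2: "t ^ 2 = M ^ 2" using that by (metis power2_abs)
    have "1 \<le> M ^ 2" using M by (rule one_le_power)
    have "M \<le> M ^ 2" using M by (simp add: self_le_power)
    have "\<bar>u + v * t + w * t ^ 2\<bar> \<le> \<bar>u\<bar> + \<bar>v\<bar> * M + \<bar>w\<bar> * M ^ 2"
      using abs_triangle_ineq[of "u + v * t" "w * t ^ 2"] abs_triangle_ineq[of u "v * t"]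
      by (simp add: abs_mult that t2)
    also have "\<dots> \<le> \<bar>u\<bar> * M ^ 2 + \<bar>v\<bar> * M ^ 2 + \<bar>w\<bar> * M ^ 2"
      using mult_left_mono[OF \<open>1 \<le> M ^ 2\<close>, of "\<bar>u\<bar>"] mult_left_mono[OF \<open>M \<le> M ^ 2\<close>, of "\<bar>v\<bar>"] by simp
    also have "\<dots> = (M - 1) * M ^ 2" by (simp add: M_def algebra_simps)
    also have "\<dots> \<le> M * M ^ 2" by (intro mult_right_mono) auto
    also have "\<dots> = M ^ 3" by (simp add: power2_eq_square power3_eq_cube)
    finally show ?thesis .
  qed
  have "f (- M) \<le> 0" "0 \<le> f M"
    using bound[of M] bound[of "- M"] M by (auto simp: f_def abs_le_iff)
  moreover have "continuous_on {- M..M} f" unfolding f_def by (intro continuous_intros)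
  ultimately obtain \<alpha> where "f \<alpha> = 0"
    using IVT'[of f "- M" 0 M] M by auto
  thus ?thesis by (auto simp: f_def)
qed

text \<open>The right-hand side is the product with \<open>x ^ 3\<close> and \<open>x ^ 4\<close>
  reduced by the relation. Any commutative ring is allowed, so that one formula serves both an
  element of the field and a real root.\<close>

lemma mult_mod_cubic:
  fixes x :: "'a::comm_ring_1"
  assumes "x ^ 3 = u + v * x + w * x ^ 2"
  shows "(p + q * x + s * x ^ 2) * (p' + q' * x + s' * x ^ 2) =
    (p * p' + (q * s' + s * q') * u + s * s' * (w * u))
    + (p * q' + q * p' + (q * s' + s * q') * v + s * s' * (u + w * v)) * x
    + (p * s' + q * q' + s * p' + (q * s' + s * q') * w + s * s' * (v + w * w)) * x ^ 2"
proof -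
  \<comment> \<open>Division with remainder: the last factor is the quotient of the product by the
    cubic.\<close>
  have "(p + q * x + s * x ^ 2) * (p' + q' * x + s' * x ^ 2) -
    ((p * p' + (q * s' + s * q') * u + s * s' * (w * u))
    + (p * q' + q * p' + (q * s' + s * q') * v + s * s' * (u + w * v)) * x
    + (p * s' + q * q' + s * p' + (q * s' + s * q') * w + s * s' * (v + w * w)) * x ^ 2)
    = (x ^ 3 - (u + v * x + w * x ^ 2)) * (q * s' + s * q' + s * s' * (x + w))"
    by (simp add: algebra_simps power2_eq_square power3_eq_cube)
  thus ?thesis using assms by simp
qed

lemma Cayley_Hamilton_3:
  fixes A :: "'a::field_char_0 ^ 3 ^ 3"
  shows "(A ** (A ** A)) $ i $ j = trace A * (A ** A) $ i $ j
    - (trace A ^ 2 - trace (A ** A)) / 2 * A $ i $ j + det A * mat 1 $ i $ j"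
proof -
  \<comment> \<open>Both sides are the second elementary symmetric function of the eigenvalues. The
    form without division leaves polynomial identities for the nine entries.\<close>
  have minors: "(trace A ^ 2 - trace (A ** A)) / 2 =
      (A $ 1 $ 1 * A $ 2 $ 2 - A $ 1 $ 2 * A $ 2 $ 1) +
      (A $ 1 $ 1 * A $ 3 $ 3 - A $ 1 $ 3 * A $ 3 $ 1) +
      (A $ 2 $ 2 * A $ 3 $ 3 - A $ 2 $ 3 * A $ 3 $ 2)"
    by (simp add: matrix_matrix_mult_def trace_def sum_3 power2_eq_square field_simps)
  have "\<forall>i j. (A ** (A ** A)) $ i $ j = trace A * (A ** A) $ i $ j
    - (trace A ^ 2 - trace (A ** A)) / 2 * A $ i $ j + det A * mat 1 $ i $ j"
    unfolding minors forall_3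
    by (simp add: matrix_matrix_mult_def trace_def det_3 mat_def sum_3; intro conjI; algebra)
  thus ?thesis by blast
qed

section \<open>Field embeddings\<close>

lemma field_embedding_of_rat:
  fixes \<sigma> :: "'a::field_char_0 \<Rightarrow> 'b::field_char_0"
  assumes "field_embedding \<sigma>"
  shows "\<sigma> (of_rat q) = of_rat q"
proof -
  have one: "\<sigma> 1 = 1" and add: "\<And>x y. \<sigma> (x + y) = \<sigma> x + \<sigma> y"
    and mult: "\<And>x y. \<sigma> (x * y) = \<sigma> x * \<sigma> y"
    using assms by (auto simp: field_embedding_def)
  have zero: "\<sigma> 0 = 0" using add[of 0 0] by simp
  have nat: "\<sigma> (of_nat n) = of_nat n" for n
    by (induction n) (simp_all add: zero one add)
  have int: "\<sigma> (of_int k) = of_int k" for k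
  proof (cases k rule: int_cases2)
    case (nonpos n)
    have "\<sigma> (- of_nat n) = - of_nat n"
      using add[of "of_nat n" "- of_nat n"]
      by (simp add: nat zero eq_neg_iff_add_eq_0 add.commute)
    thus ?thesis using nonpos by simp
  qed (simp add: nat)
  obtain a d where q: "q = Fract a d" "d > 0" by (cases q)
  have "\<sigma> (of_rat q) * of_int d = of_rat q * of_int d"
    using q int mult[of "of_rat q" "of_int d"] by (simp add: of_rat_rat)
  thus ?thesis using q by simp
qed

lemma field_embedding_sum:
  fixes \<sigma> :: "'a::field_char_0 \<Rightarrow> 'b::field_char_0"
  assumes "field_embedding \<sigma>"
  shows "\<sigma> (sum f A) = (\<Sum>i\<in>A. \<sigma> (f i))"
proof -
  have add: "\<sigma> (x + y) = \<sigma> x + \<sigma> y" for x y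
    using assms by (simp add: field_embedding_def)
  have "\<sigma> 0 + \<sigma> 0 = \<sigma> 0" using add[of 0 0] by simp
  hence "\<sigma> 0 = 0" by (metis add_cancel_right_right)
  thus ?thesis by (induction A rule: infinite_finite_induct) (simp_all add: add)
qed

lemma field_embedding_nonzero:
  assumes "field_embedding \<sigma>" "x \<noteq> 0"
  shows "\<sigma> x \<noteq> 0"
proof
  assume "\<sigma> x = 0"
  moreover have "\<sigma> (x * inverse x) = \<sigma> x * \<sigma> (inverse x)" "\<sigma> 1 = 1"
    using assms(1) unfolding field_embedding_def by blast+
  ultimately show False using assms(2) by simp
qed

section \<open>Trace, norm and \<open>Qmap\<close> in a cubic field\<close>

context
  assumes dim: "Q_vs.dim (UNIV :: 'a::field_char_0 set) = 3"
begin

lemmas ref = Q_basis_ref_basis[OF dim]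

lemma cubic_trace_add: "cubic_trace (x + y :: 'a) = cubic_trace x + cubic_trace y"
  by (simp add: cubic_trace_def mult_matrix_add[OF ref] trace_add)

lemma cubic_trace_scale: "cubic_trace (of_rat q * x :: 'a) = q * cubic_trace x"
  by (simp add: cubic_trace_def trace_def mult_matrix_scale[OF ref] sum_distrib_left)

lemma cubic_trace_of_rat: "cubic_trace (of_rat q :: 'a) = 3 * q"
  using cubic_trace_scale[of q 1]
  by (simp add: cubic_trace_def mult_matrix_1[OF ref] trace_I)

lemma cubic_trace_sum: "cubic_trace (sum f A :: 'a) = (\<Sum>i\<in>A. cubic_trace (f i))"
  using cubic_trace_of_rat[of 0]
  by (induction A rule: infinite_finite_induct) (simp_all add: cubic_trace_add)

lemma cubic_trace_diff: "cubic_trace (x - y :: 'a) = cubic_trace x - cubic_trace y"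
  using cubic_trace_add[of "x - y" y] by simp

text \<open>For nonzero \<open>x\<close>, pairing with \<open>inverse x\<close> gives the trace of
  1, which is 3.\<close>

lemma cubic_trace_nondegenerate:
  assumes "\<And>y. cubic_trace (x * y :: 'a) = 0"
  shows "x = 0"
proof (rule ccontr)
  assume "x \<noteq> 0"
  thus False using assms[of "inverse x"] cubic_trace_of_rat[of 1] by simp
qed

lemma Qmap_mult: "Qmap (x * y :: 'a) = Qmap x * Qmap y"
  by (simp add: Qmap_def cubic_norm_def mult_matrix_mult[OF ref] det_mul of_rat_mult)

text \<open>Cayley-Hamilton for multiplication by \<open>x\<close>, pulled back to the field and
  divided by \<open>x\<close>.\<close>

lemma Qmap_eq:
  assumes "x \<noteq> (0 :: 'a)"
  shows "Qmap x = x^2 - of_rat (cubic_trace x) * x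
    + of_rat ((cubic_trace x ^ 2 - cubic_trace (x^2)) / 2)"
proof -
  let ?M = "mult_matrix (ref_basis :: 3 \<Rightarrow> 'a)"
  let ?t = "cubic_trace x" and ?s = "(cubic_trace x ^ 2 - cubic_trace (x^2)) / 2"
  have "x * (x * x) + of_rat ?s * x = of_rat ?t * (x * x) + of_rat (cubic_norm x) * 1"
  proof (rule mult_matrix_inject[OF ref])
    show "?M (x * (x * x) + of_rat ?s * x) = ?M (of_rat ?t * (x * x) + of_rat (cubic_norm x) * 1)"
    proof (simp only: vec_eq_iff mult_matrix_add[OF ref] vector_add_component
            mult_matrix_scale[OF ref] mult_matrix_1[OF ref], intro allI)
      fix i j
      show "?M (x * (x * x)) $ i $ j + ?s * ?M x $ i $ j
          = ?t * ?M (x * x) $ i $ j + cubic_norm x * mat 1 $ i $ j"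
        using Cayley_Hamilton_3[of "?M x" i j]
        by (simp add: mult_matrix_mult[OF ref] cubic_trace_def cubic_norm_def power2_eq_square)
    qed
  qed
  thus ?thesis using assms by (simp add: Qmap_def field_simps power2_eq_square)
qed

lemma cubic_norm_mult: "cubic_norm (x * y :: 'a) = cubic_norm x * cubic_norm y"
  by (simp add: cubic_norm_def mult_matrix_mult[OF ref] det_mul)

lemma cubic_norm_of_rat: "cubic_norm (of_rat q :: 'a) = q ^ 3"
proof -
  have "mult_matrix ref_basis (of_rat q * 1 :: 'a) $ i $ j = (if i = j then q else 0)" for i j
    by (simp only: mult_matrix_scale[OF ref] mult_matrix_1[OF ref]) (simp add: mat_def)
  thus ?thesis by (simp add: cubic_norm_def det_3 power3_eq_cube)
qed

lemma cubic_norm_nonzero: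
  assumes "x \<noteq> (0 :: 'a)"
  shows "cubic_norm x \<noteq> 0"
  using cubic_norm_mult[of x "inverse x"] cubic_norm_of_rat[of 1] assms by auto

section \<open>Linear relations over the reals and over the rationals\<close>

lemma real_tensor_0: "real_tensor (0 :: 'a) = 0"
  using real_tensor_scale[OF dim, of 0 0] by simp

lemma real_tensor_sum: "real_tensor (sum f A :: 'a) = (\<Sum>i\<in>A. real_tensor (f i))"
  by (induction A rule: infinite_finite_induct) (simp_all add: real_tensor_0 real_tensor_add[OF dim])

text \<open>A rational relation is obtained from a real one by applying a \<open>\<rat>\<close>-linear functional on the
  reals to the coefficients.\<close>

lemma rational_relation:
  fixes w :: "'n::finite \<Rightarrow> 'a" and c :: "'n \<Rightarrow> real"
  assumes rel: "(\<Sum>i\<in>UNIV. c i *\<^sub>R real_tensor (w i)) = 0" and j: "c j \<noteq> 0"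
  obtains e where "(\<Sum>i\<in>UNIV. of_rat (e i) * w i) = 0" "e j = 1" "\<And>i. c i = 0 \<Longrightarrow> e i = 0"
proof -
  obtain f :: "real \<Rightarrow> rat" where f: "\<And>x y. f (x + y) = f x + f y"
      "\<And>q x. f (of_rat q * x) = q * f x" "f (c j) = 1"
    using exists_Q_functional[OF j] by blast
  have f0: "f 0 = 0" using f(1)[of 0 0] by simp
  have f_sum: "f (sum g A) = (\<Sum>i\<in>A. f (g i))" for g and A :: "'n set"
    by (induction A rule: infinite_finite_induct) (simp_all add: f0 f(1))
  have "(\<Sum>i\<in>UNIV. of_rat (f (c i)) * w i) = 0"
  proof (rule Q_coord_inject[OF ref], unfold vec_eq_iff, intro allI)
    fix k
    \<comment> \<open>Each coordinate of the real relation has rational factors in front of the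
      \<open>c i\<close>, and \<open>f\<close> commutes with those.\<close>
    have "(\<Sum>i\<in>UNIV. of_rat (Q_coord ref_basis (w i) $ k) * c i) = 0"
      using arg_cong[OF rel, of "\<lambda>v. v $ k"] by (simp add: real_tensor_def mult.commute[of "c _"])
    from arg_cong[OF this, of f]
    have "(\<Sum>i\<in>UNIV. f (c i) * Q_coord ref_basis (w i) $ k) = 0"
      by (simp add: f_sum f(2) f0 mult.commute[of "f _"])
    moreover have "Q_coord ref_basis (0 :: 'a) $ k = 0"
      using Q_coord_scale[OF ref, of 0 0 k] by simp
    ultimately show "Q_coord ref_basis (\<Sum>i\<in>UNIV. of_rat (f (c i)) * w i) $ k = Q_coord ref_basis (0 :: 'a) $ k"
      by (simp add: Q_coord_sum[OF ref] Q_coord_scale[OF ref])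
  qed
  thus thesis using that[of "\<lambda>i. f (c i)"] f(3) f0 by auto
qed

lemma Qmap_relation_imp:
  fixes r :: "3 \<Rightarrow> 'a"
  assumes r: "\<And>i. r i \<noteq> 0" and rel: "(\<Sum>i\<in>UNIV. of_rat (a i) * Qmap (r i)) = 0"
  shows "(\<Sum>i\<in>UNIV. of_rat (a i * cubic_trace (r i * x)) * r i) = (\<Sum>i\<in>UNIV. of_rat (a i) * r i ^ 2) * x"
proof (cases "x = 0")
  case True
  thus ?thesis using cubic_trace_of_rat[of 0] by simp
next
  case False
  define y where "y i = r i * x" for i
  define t where "t = (\<Sum>i\<in>UNIV. of_rat (a i) * y i ^ 2)"
  define u where "u = (\<Sum>i\<in>UNIV. of_rat (a i) * (of_rat (cubic_trace (y i)) * y i))"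
  define c where "c = (\<Sum>i\<in>UNIV. a i * ((cubic_trace (y i) ^ 2 - cubic_trace (y i ^ 2)) / 2))"
  \<comment> \<open>Multiplying the relation by \<open>Qmap x\<close> turns it into the one for the
    \<open>y i\<close>, as \<open>Qmap\<close> is multiplicative.\<close>
  have "0 = (\<Sum>i\<in>UNIV. of_rat (a i) * Qmap (y i))"
    using rel by (simp add: y_def Qmap_mult flip: mult.assoc sum_distrib_right)
  also have "\<dots> = t - u + of_rat c"
    using r False unfolding t_def u_def c_def
    by (simp only: of_rat_sum of_rat_mult sum.distrib[symmetric] sum_subtractf[symmetric])
      (intro sum.cong refl, simp add: Qmap_eq y_def of_rat_mult algebra_simps)
  finally have *: "t - u + of_rat c = 0" by simp
  \<comment> \<open>The constant \<open>c\<close> has trace \<open>3 * c\<close>, whereas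
    \<open>t - u\<close> has trace \<open>- 2 * c\<close>. Together these force
    \<open>c = 0\<close>, and so \<open>u = t\<close>.\<close>
  have "cubic_trace t - cubic_trace u + 3 * c = 0"
    using arg_cong[OF *, of cubic_trace] cubic_trace_of_rat[of 0]
    by (simp add: cubic_trace_add cubic_trace_diff cubic_trace_of_rat)
  moreover have "cubic_trace t - cubic_trace u = - 2 * c"
    unfolding t_def u_def c_def cubic_trace_sum cubic_trace_scale sum_subtractf[symmetric] sum_distrib_left
    by (intro sum.cong refl) (simp add: field_simps power2_eq_square)
  ultimately have "u = t" using * by simp
  hence "x * (\<Sum>i\<in>UNIV. of_rat (a i * cubic_trace (r i * x)) * r i) 
      = x * ((\<Sum>i\<in>UNIV. of_rat (a i) * r i ^ 2) * x)"
    unfolding u_def t_def y_def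
    by (simp add: sum_distrib_left sum_distrib_right of_rat_mult power2_eq_square mult_ac)
  thus ?thesis using False by simp
qed

section \<open>The dual basis for the trace pairing\<close>

context
  fixes r :: "3 \<Rightarrow> 'a"
  assumes r: "Q_basis r"
begin

lemma basis_trace_nondegenerate:
  assumes "\<And>i. cubic_trace (r i * x) = 0"
  shows "x = 0"
proof (rule cubic_trace_nondegenerate)
  fix y
  have "cubic_trace (x * y) = cubic_trace (\<Sum>i\<in>UNIV. of_rat (Q_coord r y $ i) * (r i * x))"
    by (subst Q_basis_expand[OF r, symmetric]) (simp add: sum_distrib_left mult_ac)
  thus "cubic_trace (x * y) = 0"
    by (simp add: cubic_trace_sum cubic_trace_scale assms)
qed

text \<open>The difference of two candidates is trace-orthogonal to every \<open>r i\<close>, so the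
  description by \<open>THE\<close> is unambiguous.\<close>

lemma dual_basis_eqI:
  assumes "\<And>i j. cubic_trace (r i * s j) = (if i = j then 1 else 0)"
  shows "dual_basis r = s"
  unfolding dual_basis_def
proof (rule the_equality)
  fix s' assume s': "\<forall>i j. cubic_trace (r i * s' j) = (if i = j then 1 else 0)"
  have "s' j - s j = 0" for j
    by (rule basis_trace_nondegenerate) (simp add: right_diff_distrib cubic_trace_diff s' assms)
  thus "s' = s" by (auto simp: fun_eq_iff)
qed (use assms in blast)

text \<open>Existence: the Gram matrix \<open>G\<close> is invertible by nondegeneracy, and the
  columns of its inverse are the coordinates of the dual basis.\<close>

lemma cubic_trace_dual_basis: "cubic_trace (r i * dual_basis r j) = (if i = j then 1 else 0)"
proof -
  define G :: "rat ^ 3 ^ 3" where "G = (\<chi> i j. cubic_trace (r i * r j))"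
  have "\<forall>x. G *v x = 0 \<longrightarrow> x = 0"
  proof (intro allI impI)
    fix x assume x: "G *v x = 0"
    have "(\<Sum>k\<in>UNIV. of_rat (x $ k) * r k) = 0"
    proof (rule basis_trace_nondegenerate)
      fix i
      have "cubic_trace (r i * (\<Sum>k\<in>UNIV. of_rat (x $ k) * r k))
          = (\<Sum>k\<in>UNIV. cubic_trace (of_rat (x $ k) * (r i * r k)))"
        by (simp add: sum_distrib_left cubic_trace_sum mult_ac)
      also have "\<dots> = (G *v x) $ i"
        by (simp add: cubic_trace_scale G_def matrix_vector_mult_def mult.commute)
      finally show "cubic_trace (r i * (\<Sum>k\<in>UNIV. of_rat (x $ k) * r k)) = 0"
        by (simp add: x)
    qed
    thus "x = 0" using Q_basis_independent[OF r, of "\<lambda>k. x $ k"] by (simp add: vec_eq_iff)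
  qed
  then obtain H where "H ** G = mat 1"
    unfolding matrix_left_invertible_ker[symmetric] ..
  hence H: "G ** H = mat 1" by (simp only: matrix_left_right_inverse)
  define s where "s j = (\<Sum>k\<in>UNIV. of_rat (H $ k $ j) * r k)" for j
  have "cubic_trace (r i * s j) = (if i = j then 1 else 0)" for i j
  proof -
    have "cubic_trace (r i * s j) = (\<Sum>k\<in>UNIV. cubic_trace (of_rat (H $ k $ j) * (r i * r k)))"
      by (simp add: s_def sum_distrib_left cubic_trace_sum mult_ac)
    also have "\<dots> = (G ** H) $ i $ j"
      by (simp add: cubic_trace_scale G_def matrix_matrix_mult_def mult.commute[of "cubic_trace _"])
    finally show ?thesis by (simp add: H mat_def)
  qed
  with dual_basis_eqI[of s] show ?thesis by simp
qed

lemma dual_basis_nonzero: "dual_basis r i \<noteq> 0"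
  using cubic_trace_dual_basis[of i i] cubic_trace_of_rat[of 0] by auto

lemma dual_basis_expand: "(\<Sum>i\<in>UNIV. of_rat (cubic_trace (r i * x)) * dual_basis r i) = x"
proof -
  have "(\<Sum>i\<in>UNIV. of_rat (cubic_trace (r i * x)) * dual_basis r i) - x = 0"
  proof (rule basis_trace_nondegenerate)
    fix j
    show "cubic_trace (r j * ((\<Sum>i\<in>UNIV. of_rat (cubic_trace (r i * x)) * dual_basis r i) - x)) = 0"
      by (simp add: right_diff_distrib sum_distrib_left cubic_trace_diff cubic_trace_sum
          mult.left_commute[of "r j"] cubic_trace_scale cubic_trace_dual_basis if_distrib cong: if_cong)
  qed
  thus ?thesis by simp
qed

lemma Q_coord_dual_basis: "Q_coord r x $ i = cubic_trace (x * dual_basis r i)"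
proof -
  have "cubic_trace (x * dual_basis r i)
      = cubic_trace ((\<Sum>k\<in>UNIV. of_rat (Q_coord r x $ k) * r k) * dual_basis r i)"
    by (simp only: Q_basis_expand[OF r])
  also have "\<dots> = cubic_trace (\<Sum>k\<in>UNIV. of_rat (Q_coord r x $ k) * (r k * dual_basis r i))"
    by (simp only: sum_distrib_right mult.assoc)
  finally have "cubic_trace (x * dual_basis r i) = \<dots>" .
  thus ?thesis
    by (simp add: cubic_trace_sum cubic_trace_scale cubic_trace_dual_basis if_distrib cong: if_cong)
qed

text \<open>The diagonal entries of the matrix of \<open>y\<close> in the basis \<open>r\<close> are
  the traces of \<open>y * r i * dual_basis r i\<close>, so \<open>y\<close> and \<open>y\<close>
  times the sum have equal trace for every \<open>y\<close>.\<close>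

lemma sum_dual_basis: "(\<Sum>i\<in>UNIV. r i * dual_basis r i) = 1"
proof -
  have "(\<Sum>i\<in>UNIV. r i * dual_basis r i) - 1 = 0"
  proof (rule cubic_trace_nondegenerate)
    fix y
    have "cubic_trace y = (\<Sum>i\<in>UNIV. cubic_trace (y * r i * dual_basis r i))"
      by (subst cubic_trace_eq[OF dim r]) (simp add: trace_def mult_matrix_def Q_coord_dual_basis)
    moreover have "((\<Sum>i\<in>UNIV. r i * dual_basis r i) - 1) * y
        = (\<Sum>i\<in>UNIV. y * r i * dual_basis r i) - y"
      by (simp add: right_diff_distrib sum_distrib_left mult.assoc mult.commute[of _ y])
    ultimately show "cubic_trace (((\<Sum>i\<in>UNIV. r i * dual_basis r i) - 1) * y) = 0"
      by (simp only: cubic_trace_diff cubic_trace_sum)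
  qed
  thus ?thesis by simp
qed

text \<open>Multiply \<open>of_rat (a i) * r i = t * dual_basis r i\<close> by \<open>r i\<close>
  and sum, using \<open>sum_dual_basis\<close>. For positive \<open>a i\<close> this exhibits
  \<open>t\<close> as a positive combination of squares.\<close>

lemma sum_squares_dual_basis:
  assumes a: "\<And>i. a i \<noteq> 0" and t: "\<And>i. r i / dual_basis r i = t / of_rat (a i)"
  shows "(\<Sum>i\<in>UNIV. of_rat (a i) * r i ^ 2) = t"
proof -
  have dual: "of_rat (a i) * r i = t * dual_basis r i" for i
    using a[of i] dual_basis_nonzero[of i] t[of i] by (simp add: frac_eq_eq mult.commute)
  have "of_rat (a i) * r i ^ 2 = t * (r i * dual_basis r i)" for i
    using arg_cong[OF dual[of i], of "(*) (r i)"] by (simp add: power2_eq_square mult_ac)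
  thus ?thesis using sum_dual_basis by (simp flip: sum_distrib_left)
qed

lemma Qmap_relation_iff:
  assumes a: "\<And>i. a i \<noteq> 0"
  shows "(\<Sum>i\<in>UNIV. of_rat (a i) * Qmap (r i)) = 0 \<longleftrightarrow>
    (\<exists>t. t \<noteq> 0 \<and> (\<forall>i. r i / dual_basis r i = t / of_rat (a i)))"
    (is "?L \<longleftrightarrow> ?R")
proof
  assume ?L
  define t where "t = (\<Sum>i\<in>UNIV. of_rat (a i) * r i ^ 2)"
  have *: "(\<Sum>i\<in>UNIV. of_rat (a i * cubic_trace (r i * x)) * r i) = t * x" for x
    unfolding t_def by (rule Qmap_relation_imp[OF Q_basis_nonzero[OF r] \<open>?L\<close>])
  \<comment> \<open>At \<open>x = dual_basis r j\<close> only the summand with index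
    \<open>j\<close> survives.\<close>
  have dual: "of_rat (a j) * r j = t * dual_basis r j" for j
    using *[of "dual_basis r j"] by (simp add: cubic_trace_dual_basis if_distrib if_distribR cong: if_cong)
  have "t \<noteq> 0" using dual[of 1] a[of 1] Q_basis_nonzero[OF r, of 1] by auto
  moreover have "r i / dual_basis r i = t / of_rat (a i)" for i
    using dual[of i] a[of i] dual_basis_nonzero[of i] by (simp add: field_simps)
  ultimately show ?R by blast
next
  assume ?R
  then obtain t where t: "t \<noteq> 0" "\<And>i. r i / dual_basis r i = t / of_rat (a i)" by blast
  have dual: "of_rat (a i) * r i = t * dual_basis r i" for i
    using a[of i] dual_basis_nonzero[of i] t(2)[of i] by (simp add: frac_eq_eq mult.commute)
  have sq: "(\<Sum>i\<in>UNIV. of_rat (a i) * r i ^ 2) = t"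
    using sum_squares_dual_basis[OF a t(2)] .
  \<comment> \<open>This is \<open>t\<close> times the expansion of 1 in the dual basis.\<close>
  have lin: "(\<Sum>i\<in>UNIV. of_rat (a i) * (of_rat (cubic_trace (r i)) * r i)) = t"
  proof -
    have "of_rat (a i) * (of_rat (cubic_trace (r i)) * r i)
        = t * (of_rat (cubic_trace (r i * 1)) * dual_basis r i)" for i
      using arg_cong[OF dual[of i], of "(*) (of_rat (cubic_trace (r i)))"] by (simp add: mult_ac)
    thus ?thesis by (simp only: dual_basis_expand flip: sum_distrib_left) simp
  qed
  \<comment> \<open>The constant terms amount to half the difference of the traces of the linear and
    the quadratic sum, both of which equal \<open>t\<close>.\<close>
  have "(\<Sum>i\<in>UNIV. a i * ((cubic_trace (r i) ^ 2 - cubic_trace (r i ^ 2)) / 2))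
      = (cubic_trace (\<Sum>i\<in>UNIV. of_rat (a i) * (of_rat (cubic_trace (r i)) * r i))
        - cubic_trace (\<Sum>i\<in>UNIV. of_rat (a i) * r i ^ 2)) / 2"
    unfolding cubic_trace_sum cubic_trace_scale sum_subtractf[symmetric] sum_divide_distrib
    by (intro sum.cong refl) (simp add: field_simps power2_eq_square)
  also have "\<dots> = 0" by (simp only: lin sq) simp
  finally have const: "(\<Sum>i\<in>UNIV. a i * ((cubic_trace (r i) ^ 2 - cubic_trace (r i ^ 2)) / 2)) = 0" .
  have "(\<Sum>i\<in>UNIV. of_rat (a i) * Qmap (r i))
      = (\<Sum>i\<in>UNIV. of_rat (a i) * r i ^ 2)
        - (\<Sum>i\<in>UNIV. of_rat (a i) * (of_rat (cubic_trace (r i)) * r i))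
        + of_rat (\<Sum>i\<in>UNIV. a i * ((cubic_trace (r i) ^ 2 - cubic_trace (r i ^ 2)) / 2))"
    by (simp only: of_rat_sum of_rat_mult sum.distrib[symmetric] sum_subtractf[symmetric])
      (intro sum.cong refl, simp add: Qmap_eq Q_basis_nonzero[OF r] of_rat_mult algebra_simps)
  thus ?L by (simp only: sq lin const) simp
qed

section \<open>Admissibility as a positive rational relation\<close>

lemma Q_basis_pair_independent:
  assumes "i \<noteq> j" "of_rat p * r i + of_rat q * r j = 0"
  shows "p = 0"
proof -
  define c where "c k = (if k = i then p else if k = j then q else 0)" for k
  have "(\<Sum>k\<in>UNIV. of_rat (c k) * r k) = (\<Sum>k\<in>{i, j}. of_rat (c k) * r k)"
    by (rule sum.mono_neutral_right) (simp_all add: c_def)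
  also have "\<dots> = 0"
    using assms by (simp add: c_def)
  finally have "c i = 0" by (rule Q_basis_independent[OF r])
  thus ?thesis by (simp add: c_def)
qed

text \<open>Norms are rational, so multiplying by \<open>r i * r j\<close> leaves a rational
  relation between \<open>r i\<close> and \<open>r j\<close>, with the two coefficients
  exchanged.\<close>

lemma Qmap_pair_independent:
  assumes ij: "i \<noteq> j" and "of_rat p * Qmap (r i) + of_rat q * Qmap (r j) = 0"
  shows "p = 0"
proof -
  have "of_rat (q * cubic_norm (r j)) * r i + of_rat (p * cubic_norm (r i)) * r j = 0"
    using assms(2) Q_basis_nonzero[OF r] by (simp add: Qmap_def of_rat_mult field_simps)
  hence "of_rat (p * cubic_norm (r i)) * r j + of_rat (q * cubic_norm (r j)) * r i = 0"
    by (simp only: add.commute)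
  hence "p * cubic_norm (r i) = 0"
    using ij by (intro Q_basis_pair_independent[of j i]) auto
  thus ?thesis using cubic_norm_nonzero[OF Q_basis_nonzero[OF r]] by simp
qed

lemma Qmap_relation_zero:
  assumes rel: "(\<Sum>i\<in>UNIV. of_rat (e i) * Qmap (r i)) = 0" and "e k = 0"
  shows "e i = 0"
proof (cases "i = k")
  case False
  then obtain j where j: "j \<noteq> i" "j \<noteq> k" "UNIV = {i, j, k}" by (rule third_index)
  hence "of_rat (e i) * Qmap (r i) + of_rat (e j) * Qmap (r j) = 0"
    using rel False assms(2) by (simp add: j(3))
  with j(1) show ?thesis using Qmap_pair_independent[of i j] by blast
qed (use assms in simp)

text \<open>A counterexample would yield, by \<open>rational_relation\<close>, a rational one with
  the same zero at \<open>k\<close>. Consequently a real relation is determined by any one of its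
  coefficients.\<close>

lemma real_relation_zero:
  assumes rel: "(\<Sum>i\<in>UNIV. c i *\<^sub>R real_tensor (Qmap (r i))) = 0" and "c k = 0"
  shows "c i = 0"
proof (rule ccontr)
  assume "c i \<noteq> 0"
  from rational_relation[OF rel this] obtain e
    where "(\<Sum>i\<in>UNIV. of_rat (e i) * Qmap (r i)) = 0" "e i = 1" "e k = 0"
    using assms(2) by metis
  thus False using Qmap_relation_zero by fastforce
qed

text \<open>Convex combinations in \<open>admissible\<close> run over a set of points; injectivity
  lets them be indexed by the three basis elements.\<close>

lemma inj_Qmap_basis: "inj (\<lambda>i. real_tensor (Qmap (r i)))"
proof (rule injI, rule ccontr)
  fix i j assume eq: "real_tensor (Qmap (r i)) = real_tensor (Qmap (r j))" and "i \<noteq> j"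
  from \<open>i \<noteq> j\<close> obtain k where k: "k \<noteq> i" "k \<noteq> j" by (rule third_index)
  define c :: "3 \<Rightarrow> real" where "c m = (if m = i then 1 else 0) - (if m = j then 1 else 0)" for m
  have "c m *\<^sub>R real_tensor (Qmap (r m)) = (if m = i then real_tensor (Qmap (r m)) else 0)
      - (if m = j then real_tensor (Qmap (r m)) else 0)" for m
    by (simp add: c_def)
  hence "(\<Sum>m\<in>UNIV. c m *\<^sub>R real_tensor (Qmap (r m))) = 0"
    using eq by (simp add: sum_subtractf)
  from real_relation_zero[OF this, of k i] show False using k \<open>i \<noteq> j\<close> by (simp add: c_def)
qed

text \<open>Forwards, convex weights representing 0 cannot vanish anywhere, and they are
  proportional to rationals. Backwards, strictly positive weights put 0 into the relative interior
  of the hull.\<close>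

lemma admissible_iff_relation:
  "admissible r \<longleftrightarrow>
    (\<exists>a. (\<forall>i. a i > 0) \<and> (\<Sum>i\<in>UNIV. of_rat (a i) * Qmap (r i)) = 0)"
proof -
  define p where "p i = real_tensor (Qmap (r i))" for i
  have inj: "inj p" using inj_Qmap_basis by (simp add: p_def[abs_def])
  have indep: "c i = 0" if "(\<Sum>i\<in>UNIV. c i *\<^sub>R p i) = 0" "c k = 0" for c i k
    using real_relation_zero that by (simp add: p_def)
  have real_rel: "(\<Sum>i\<in>UNIV. of_rat (a i) *\<^sub>R p i) = 0"
    if "(\<Sum>i\<in>UNIV. of_rat (a i) * Qmap (r i)) = 0" for a
    using arg_cong[OF that, of real_tensor] by (simp add: p_def real_tensor_sum real_tensor_scale[OF dim] real_tensor_0)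
  have adm: "admissible r \<longleftrightarrow> 0 \<in> top_of_set (span (range p)) interior_of (convex hull (range p))"
    by (simp add: admissible_def p_def[abs_def] Let_def)
  show ?thesis
  proof
    assume "admissible r"
    hence "0 \<in> convex hull (range p)"
      using adm interior_of_subset[of _ "convex hull (range p)"] by (simp add: subset_iff)
    then obtain u where u: "\<forall>x\<in>range p. 0 \<le> u x" "sum u (range p) = 1"
        "(\<Sum>x\<in>range p. u x *\<^sub>R x) = 0"
      by (auto simp: convex_hull_finite)
    define c where "c i = u (p i)" for i
    have c: "\<And>i. c i \<ge> 0" "sum c UNIV = 1" "(\<Sum>i\<in>UNIV. c i *\<^sub>R p i) = 0"
      using u by (simp_all add: sum.reindex[OF inj] c_def o_def)
    have pos: "c i > 0" for i
    proof (rule ccontr)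
      assume "\<not> c i > 0"
      hence "c i = 0" using c(1)[of i] by simp
      hence "c j = 0" for j using indep[OF c(3)] by blast
      with c(2) show False by simp
    qed
    obtain e where e: "(\<Sum>i\<in>UNIV. of_rat (e i) * Qmap (r i)) = 0" "e 1 = 1"
      using rational_relation[of c "\<lambda>i. Qmap (r i)" 1] c(3) pos[of 1] by (auto simp: p_def)
    \<comment> \<open>Two relations agreeing at index 1 coincide, so \<open>c\<close> divided by
      \<open>c 1\<close> is the rational relation \<open>e\<close>.\<close>
    have "(\<Sum>i\<in>UNIV. (of_rat (e i) - c i / c 1) *\<^sub>R p i)
        = (\<Sum>i\<in>UNIV. of_rat (e i) *\<^sub>R p i) - (1 / c 1) *\<^sub>R (\<Sum>i\<in>UNIV. c i *\<^sub>R p i)"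
      by (simp add: scaleR_diff_left sum_subtractf scaleR_sum_right)
    also have "\<dots> = 0" by (simp add: real_rel[OF e(1)] c(3))
    finally have "of_rat (e i) - c i / c 1 = 0" for i
      by (rule indep[where k = 1]) (use pos[of 1] in \<open>simp add: e(2)\<close>)
    hence "real_of_rat (e i) = c i / c 1" for i by (metis eq_iff_diff_eq_0)
    hence "real_of_rat (e i) > 0" for i using pos by simp
    with e(1) show "\<exists>a. (\<forall>i. a i > 0) \<and> (\<Sum>i\<in>UNIV. of_rat (a i) * Qmap (r i)) = 0"
      by (metis zero_less_of_rat_iff)
  next
    assume "\<exists>a. (\<forall>i. a i > 0) \<and> (\<Sum>i\<in>UNIV. of_rat (a i) * Qmap (r i)) = 0"
    then obtain a where a: "\<And>i. a i > 0" "(\<Sum>i\<in>UNIV. of_rat (a i) * Qmap (r i)) = 0" by blast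
    define A where "A = (\<Sum>i\<in>UNIV. real_of_rat (a i))"
    have "A > 0" unfolding A_def using a(1) by (intro sum_pos) auto
    define u where "u x = real_of_rat (a (inv p x)) / A" for x
    have u: "u (p i) = of_rat (a i) / A" for i using inj by (simp add: u_def)
    have "\<forall>x\<in>range p. 0 < u x" using a(1) u \<open>A > 0\<close> by auto
    moreover have "sum u (range p) = 1"
      using \<open>A > 0\<close> by (simp add: sum.reindex[OF inj] o_def u A_def flip: sum_divide_distrib)
    moreover have "(\<Sum>x\<in>range p. u x *\<^sub>R x) = 0"
    proof -
      have "(\<Sum>x\<in>range p. u x *\<^sub>R x) = (1 / A) *\<^sub>R (\<Sum>i\<in>UNIV. of_rat (a i) *\<^sub>R p i)"
        by (simp add: sum.reindex[OF inj] o_def u scaleR_sum_right)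
      thus ?thesis by (simp add: real_rel[OF a(2)])
    qed
    ultimately have "0 \<in> {y. \<exists>u. (\<forall>x\<in>range p. 0 < u x) \<and> sum u (range p) = 1 \<and>
        (\<Sum>x\<in>range p. u x *\<^sub>R x) = y}"
      by (intro CollectI exI[of _ u] conjI)
    hence int: "0 \<in> rel_interior (convex hull (range p))"
      by (rule subsetD[OF explicit_subset_rel_interior_convex_hull_minimal, rotated]) simp
    have "0 \<in> convex hull (range p)" using int rel_interior_subset by blast
    \<comment> \<open>The affine hull contains 0 and is therefore the span, so the relative interior
      is the interior asked for in \<open>admissible\<close>.\<close>
    hence "affine hull (convex hull (range p)) = span (range p)"
      using affine_hull_span_0[of "range p"] convex_hull_subset_affine_hull
      by (auto simp: affine_hull_convex_hull)
    with int show "admissible r" by (simp add: adm rel_interior_def interior_of_def)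
  qed
qed

end

section \<open>Existence of a real embedding\<close>

text \<open>Taking norms gives \<open>N(z)\<^sup>2 = d\<^sup>3\<close>, so \<open>d\<close> is already a square in the rationals.\<close>

lemma cubic_square_rational:
  assumes "z ^ 2 = (of_rat d :: 'a)"
  shows "z \<in> \<rat>"
proof (cases "d = 0")
  case False
  have "cubic_norm z ^ 2 = d ^ 3"
    using assms cubic_norm_mult[of z z] cubic_norm_of_rat[of d] by (simp add: power2_eq_square)
  hence "d = (cubic_norm z / d) ^ 2"
    using False by (simp add: field_simps power2_eq_square power3_eq_cube)
  hence "z ^ 2 = of_rat (cubic_norm z / d) ^ 2"
    using assms by (metis of_rat_power)
  hence "z = of_rat (cubic_norm z / d) \<or> z = of_rat (- (cubic_norm z / d))"
    by (simp add: power2_eq_iff of_rat_minus)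
  thus ?thesis by (metis Rats_of_rat)
qed (use assms in simp)

text \<open>A cubic field has no elements of degree 2: completing the square makes a shift of
  \<open>x\<close> a square root of a rational, hence rational by
  \<open>cubic_square_rational\<close>.\<close>

lemma cubic_powers_independent:
  assumes x: "(x :: 'a) \<notin> \<rat>" and rel: "of_rat a + of_rat b * x + of_rat c * x ^ 2 = 0"
  shows "a = 0 \<and> b = 0 \<and> c = 0"
proof -
  have "c = 0"
  proof (rule ccontr)
    assume c: "c \<noteq> 0"
    define m d where "m = b / c / 2" and "d = a / c"
    have "a = c * d" "b = c * (2 * m)" using c by (simp_all add: m_def d_def)
    hence "of_rat a + of_rat b * x + of_rat c * x ^ 2
        = of_rat c * (x ^ 2 + 2 * of_rat m * x + of_rat d)"
      by (simp only: of_rat_mult of_rat_numeral_eq) (simp only: algebra_simps)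
    hence "x ^ 2 + 2 * of_rat m * x + of_rat d = 0"
      using rel c by simp
    moreover have "(x + of_rat m) ^ 2 - (of_rat m ^ 2 - of_rat d) = x ^ 2 + 2 * of_rat m * x + of_rat d"
      by (simp add: power2_eq_square algebra_simps)
    ultimately have "(x + of_rat m) ^ 2 = of_rat m ^ 2 - of_rat d" by simp
    hence "(x + of_rat m) ^ 2 = of_rat (m ^ 2 - d)"
      by (simp add: of_rat_diff of_rat_power)
    hence "x + of_rat m \<in> \<rat>" by (rule cubic_square_rational)
    hence "x + of_rat m - of_rat m \<in> \<rat>" by (intro Rats_diff) auto
    thus False using x by simp
  qed
  moreover have "b = 0"
  proof (rule ccontr)
    assume b: "b \<noteq> 0"
    have "x = of_rat (- a / b)"
      using rel b \<open>c = 0\<close> by (simp add: of_rat_divide of_rat_minus field_simps eq_neg_iff_add_eq_0)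
    thus False using x by (metis Rats_of_rat)
  qed
  ultimately show ?thesis using rel by simp
qed

lemma exists_irrational: "\<exists>x::'a. x \<notin> \<rat>"
proof (rule ccontr)
  assume "\<nexists>x::'a. x \<notin> \<rat>"
  hence "(ref_basis 1 :: 'a) \<in> \<rat>" "(ref_basis 2 :: 'a) \<in> \<rat>" by auto
  then obtain p q where pq: "(ref_basis 1 :: 'a) = of_rat p" "(ref_basis 2 :: 'a) = of_rat q"
    by (auto elim!: Rats_cases)
  hence "of_rat q * ref_basis 1 + of_rat (- p) * (ref_basis 2 :: 'a) = 0"
    by (simp add: of_rat_minus)
  hence "q = 0" by (rule Q_basis_pair_independent[OF ref, rotated]) simp
  thus False using pq Q_basis_nonzero[OF ref, of 2] by simp
qed

text \<open>An irrational \<open>x\<close> generates the field with basis \<open>1\<close>,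
  \<open>x\<close>, \<open>x ^ 2\<close>; send it to a real root of the cubic that it
  satisfies.\<close>

lemma exists_real_embedding: "\<exists>\<sigma> :: 'a \<Rightarrow> real. field_embedding \<sigma>"
proof -
  obtain x :: 'a where x: "x \<notin> \<rat>" using exists_irrational by blast
  define b :: "3 \<Rightarrow> 'a" where "b i = (if i = 1 then 1 else if i = 2 then x else x ^ 2)" for i
  have b_sum: "(\<Sum>i\<in>UNIV. of_rat (c $ i) * b i)
      = of_rat (c $ 1) + of_rat (c $ 2) * x + of_rat (c $ 3) * x ^ 2" for c :: "rat ^ 3"
    by (simp add: sum_3 b_def)
  have "c = 0" if "(\<Sum>i\<in>UNIV. of_rat (c $ i) * b i) = 0" for c :: "rat ^ 3"
    using cubic_powers_independent[OF x that[unfolded b_sum]] by (simp add: vec_eq_iff forall_3)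
  from independent_imp_coords[of ref_basis b, OF ref this]
  have "\<forall>y. \<exists>!c :: rat ^ 3. of_rat (c $ 1) + of_rat (c $ 2) * x + of_rat (c $ 3) * x ^ 2 = y"
    unfolding b_sum by blast
  then obtain C :: "'a \<Rightarrow> rat ^ 3"
    where C: "\<And>y. of_rat (C y $ 1) + of_rat (C y $ 2) * x + of_rat (C y $ 3) * x ^ 2 = y"
      and C_unique: "\<And>y c. of_rat (c $ 1) + of_rat (c $ 2) * x + of_rat (c $ 3) * x ^ 2 = y \<Longrightarrow> c = C y"
    by metis
  define u v w where "u = C (x ^ 3) $ 1" and "v = C (x ^ 3) $ 2" and "w = C (x ^ 3) $ 3"
  have x3: "x ^ 3 = of_rat u + of_rat v * x + of_rat w * x ^ 2"
    unfolding u_def v_def w_def by (rule C[symmetric])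
  obtain \<alpha> :: real where \<alpha>: "\<alpha> ^ 3 = of_rat u + of_rat v * \<alpha> + of_rat w * \<alpha> ^ 2"
    using real_cubic_root by blast
  define \<sigma> where "\<sigma> y = of_rat (C y $ 1) + of_rat (C y $ 2) * \<alpha> + of_rat (C y $ 3) * \<alpha> ^ 2" for y
  \<comment> \<open>By uniqueness of coordinates, \<open>\<sigma>\<close> can be read off from any
    expression of \<open>y\<close> in powers of \<open>x\<close>.\<close>
  have \<sigma>: "\<sigma> y = of_rat p + of_rat q * \<alpha> + of_rat s * \<alpha> ^ 2"
    if "y = of_rat p + of_rat q * x + of_rat s * x ^ 2" for y p q s
  proof -
    have "vector [p, q, s] = C y" by (rule C_unique) (simp add: that)
    thus ?thesis by (simp add: \<sigma>_def flip: \<open>vector [p, q, s] = C y\<close>)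
  qed
  have "field_embedding \<sigma>"
    unfolding field_embedding_def
  proof (intro conjI allI)
    show "\<sigma> 1 = 1" using \<sigma>[of 1 1 0 0] by simp
    fix y z
    have "y + z = (of_rat (C y $ 1) + of_rat (C y $ 2) * x + of_rat (C y $ 3) * x ^ 2)
        + (of_rat (C z $ 1) + of_rat (C z $ 2) * x + of_rat (C z $ 3) * x ^ 2)"
      by (simp only: C)
    also have "\<dots> = of_rat (C y $ 1 + C z $ 1) + of_rat (C y $ 2 + C z $ 2) * x
        + of_rat (C y $ 3 + C z $ 3) * x ^ 2"
      by (simp only: of_rat_add algebra_simps)
    finally show "\<sigma> (y + z) = \<sigma> y + \<sigma> z"
      by (subst \<sigma>) (assumption, simp only: \<sigma>_def of_rat_add algebra_simps)
    define p q s where "p = C y $ 1 * C z $ 1 + (C y $ 2 * C z $ 3 + C y $ 3 * C z $ 2) * u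
        + C y $ 3 * C z $ 3 * (w * u)"
      and "q = C y $ 1 * C z $ 2 + C y $ 2 * C z $ 1 + (C y $ 2 * C z $ 3 + C y $ 3 * C z $ 2) * v
        + C y $ 3 * C z $ 3 * (u + w * v)"
      and "s = C y $ 1 * C z $ 3 + C y $ 2 * C z $ 2 + C y $ 3 * C z $ 1
        + (C y $ 2 * C z $ 3 + C y $ 3 * C z $ 2) * w + C y $ 3 * C z $ 3 * (v + w * w)"
    have "y * z = (of_rat (C y $ 1) + of_rat (C y $ 2) * x + of_rat (C y $ 3) * x ^ 2)
        * (of_rat (C z $ 1) + of_rat (C z $ 2) * x + of_rat (C z $ 3) * x ^ 2)"
      by (simp only: C)
    also have "\<dots> = of_rat p + of_rat q * x + of_rat s * x ^ 2"
      unfolding mult_mod_cubic[OF x3] by (simp only: p_def q_def s_def of_rat_add of_rat_mult)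
    finally have "\<sigma> (y * z) = of_rat p + of_rat q * \<alpha> + of_rat s * \<alpha> ^ 2" by (rule \<sigma>)
    also have "\<dots> = \<sigma> y * \<sigma> z"
      unfolding \<sigma>_def mult_mod_cubic[OF \<alpha>] by (simp only: p_def q_def s_def of_rat_add of_rat_mult)
    finally show "\<sigma> (y * z) = \<sigma> y * \<sigma> z" .
  qed
  thus ?thesis by blast
qed

end

theorem proposition7p2:
  fixes r :: "3 \<Rightarrow> 'a::field_char_0"
  assumes "totally_real_cubic_field TYPE('a)"
    and "Q_basis r"
  shows "admissible r \<longleftrightarrow> rational_basis r \<and> positive_basis r"
proof -
  have dim: "Q_vs.dim (UNIV :: 'a set) = 3"
    using assms(1) by (simp add: totally_real_cubic_field_def)
  note r = assms(2)
  note nz = Q_basis_nonzero[OF r] dual_basis_nonzero[OF dim r]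
  show ?thesis
  proof (intro iffI conjI)
    assume "admissible r"
    then obtain a t where a: "\<And>i. a i > 0"
      and t: "t \<noteq> 0" "\<And>i. r i / dual_basis r i = t / of_rat (a i)"
      using Qmap_relation_iff[OF dim r] unfolding admissible_iff_relation[OF dim r]
      by (metis less_numeral_extra(3))
    have a0: "a i \<noteq> 0" for i using a[of i] by simp
    have "(r i / dual_basis r i) / (r j / dual_basis r j) = of_rat (a j / a i)" for i j
      using t(1) a0 by (simp add: t(2) of_rat_divide)
    thus "rational_basis r" unfolding rational_basis_def by (metis Rats_of_rat)
    show "positive_basis r"
      unfolding positive_basis_def totally_positive_def
    proof (intro allI impI)
      fix i and \<sigma> :: "'a \<Rightarrow> real" assume \<sigma>: "field_embedding \<sigma>"
      hence mult: "\<sigma> (x * y) = \<sigma> x * \<sigma> y" for x y by (simp add: field_embedding_def)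
      \<comment> \<open>\<open>t\<close> is the sum of the \<open>of_rat (a i) * r i ^ 2\<close>, so
        its image is a sum of positive reals.\<close>
      have "\<sigma> t = (\<Sum>i\<in>UNIV. of_rat (a i) * \<sigma> (r i) ^ 2)"
        by (simp add: mult field_embedding_sum[OF \<sigma>] field_embedding_of_rat[OF \<sigma>] power2_eq_square
            flip: sum_squares_dual_basis[OF dim r a0 t(2)])
      also have "\<dots> > 0"
        using a field_embedding_nonzero[OF \<sigma> nz(1)] by (intro sum_pos mult_pos_pos) auto
      finally have "\<sigma> t > 0" .
      moreover have "\<sigma> t = \<sigma> (r i / dual_basis r i) * of_rat (a i)"
        using mult[of "t / of_rat (a i)" "of_rat (a i)"] a0[of i]
        by (simp add: t(2) field_embedding_of_rat[OF \<sigma>])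
      ultimately show "\<sigma> (r i / dual_basis r i) > 0"
        using a[of i] by (simp add: zero_less_mult_iff)
    qed
  next
    assume "rational_basis r \<and> positive_basis r"
    hence rat: "rational_basis r" and pos: "positive_basis r" by auto
    \<comment> \<open>Normalised so that \<open>a 1 = 1\<close>; the index 1 is treated apart below
      because \<open>rational_basis\<close> compares distinct indices only.\<close>
    define t where "t = r 1 / dual_basis r 1"
    have "\<exists>q. t / (r i / dual_basis r i) = of_rat q" for i
    proof (cases "i = 1")
      case True
      thus ?thesis using nz by (intro exI[of _ 1]) (simp add: t_def)
    next
      case False
      hence "t / (r i / dual_basis r i) \<in> \<rat>"
        using rat by (simp add: rational_basis_def t_def)
      thus ?thesis by (auto elim: Rats_cases)
    qed
    then obtain a where a: "\<And>i. t / (r i / dual_basis r i) = of_rat (a i)" by metis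
    have t: "t \<noteq> 0" using nz by (simp add: t_def)
    have a0: "a i \<noteq> 0" for i using a[of i] t nz by auto
    have quot: "r i / dual_basis r i = t / of_rat (a i)" for i
      using nz t by (simp flip: a)
    \<comment> \<open>Total positivity quantifies over real embeddings, so an actual embedding is
      required to extract signs from it.\<close>
    obtain \<sigma> :: "'a \<Rightarrow> real" where \<sigma>: "field_embedding \<sigma>"
      using exists_real_embedding[OF dim] by blast
    hence \<sigma>_pos: "\<sigma> (r i / dual_basis r i) > 0" for i
      using pos by (simp add: positive_basis_def totally_positive_def)
    have "a i > 0" for i
    proof -
      have "\<sigma> (t / of_rat (a i) * of_rat (a i)) = \<sigma> (t / of_rat (a i)) * \<sigma> (of_rat (a i))"
        using \<sigma> unfolding field_embedding_def by blast
      hence "\<sigma> t = \<sigma> (r i / dual_basis r i) * of_rat (a i)"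
        using a0[of i] by (simp add: quot field_embedding_of_rat[OF \<sigma>])
      \<comment> \<open>Index 1 gives the sign of \<open>\<sigma> t\<close>, index \<open>i\<close>
        that of the other factor.\<close>
      thus ?thesis using \<sigma>_pos[of 1] \<sigma>_pos[of i] by (simp add: zero_less_mult_iff flip: t_def)
    qed
    moreover have "(\<Sum>i\<in>UNIV. of_rat (a i) * Qmap (r i)) = 0"
      using Qmap_relation_iff[OF dim r, of a] a0 t quot by blast
    ultimately show "admissible r" unfolding admissible_iff_relation[OF dim r] by blast
  qed
qed

end
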